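(* Let $(\mathcal{A},\Omega,\Diamond,\mathcal{S})$ be a monadic core. Then the triple $\left(\Omega^{\mathcal{A}},\ \mathcal{S},\ \cdot\xrightarrow{\cdot}\cdot\right)$ forms an evidenced frame, where for $\phi_1,\phi_2:\mathcal{A}\to\Omega$ and $e\in\mathcal{S}$ the evidence relation is \[\phi_1\xrightarrow{e}\phi_2 \;:=\; \forall c\in\mathcal{A}.\ \phi_1(c)\le \Diamond(e\cdot c)(\phi_2).\]
   Context: $M$ is a monad on $\mathbf{Set}$ with unit $\eta$ and bind. A monadic combinatory algebra (MCA) $\mathcal{A}$ over $M$ is a set of codes with an application $(-)\cdot(-):\mathcal{A}\times\mathcal{A}\to M\mathcal{A}$ such that every expression $e$ with $n+1$ free variables (built from variables, codes and application) has a code $\langle\lambda^n.e\rangle\in\mathcal{A}$ with $\langle\lambda^{n+1}.e\rangle\cdot c=\eta(\langle\lambda^n.e[c]\rangle)$ and $\langle\lambda^0.e\rangle\cdot c=\nu(e[c])$, where $\nu$ is call-by-value evaluation of closed expressions via return/bind. $(\Omega,\le)$ is a complete Heyting prealgebra with meets $\bigwedge$ (infima), top $\mathbf{1}$, bottom $\mathbf{0}$ and Heyting implication $\Rightarrow$. An $M$-modality is a natural transformation $\Diamond_X:M(X)\to(X\to\Omega)\to\Omega$ (write $\Diamond(m)(\phi)$, read "after $m$ yields $x$, $\phi(x)$ holds") satisfying: (After-Return) $\phi(a)\le\Diamond(\eta(a))(\phi)$; (After-Bind) $\Diamond(m)(\lambda x.\Diamond(f(x))(\phi))\le\Diamond(\mathrm{bind}(m,f))(\phi)$;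 (Internal Monotonicity) $\bigwedge_c(\phi_1(c)\Rightarrow\phi_2(c))\le\Diamond(m)(\phi_1)\Rightarrow\Diamond(m)(\phi_2)$. A separator $\mathcal{S}\subseteq\mathcal{A}$ is a combinatorially complete subset such that for all $c_f,c_a\in\mathcal{S}$, $\Diamond(c_f\cdot c_a)(\lambda r.\mathbf{0})\le\mathbf{0}$. A monadic core is such a tuple $(\mathcal{A},\Omega,\Diamond,\mathcal{S})$. An evidenced frame $(\Phi,E,\cdot\xrightarrow{\cdot}\cdot)$ is a set of propositions $\Phi$, a set of evidence $E$ and a ternary relation on $\Phi\times E\times\Phi$, equipped with evidence for reflexivity and transitivity (composition of evidence), a top proposition, conjunction (pairing and two projections), and universal implication $\supset:\Phi\times\mathcal{P}(\Phi)\to\Phi$ (with currying $\lambda$ and an evaluation evidence), each satisfying the evidenced analogues of the Heyting prealgebra axioms uniformly. *)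

theory Defs
  imports Main "HOL-Library.FuncSet"
begin

text \<open>
  HOL has no type of all sets and cannot quantify over type constructors.  Sets are therefore
  subsets of a type \<open>'u\<close>, and the category of sets is given by an arbitrary collection \<open>Obj\<close>
  of them; the morphisms from \<open>X\<close> to \<open>Y\<close> are all functions \<open>X \<rightarrow>\<^sub>E Y\<close>.  Both \<open>'u\<close> and
  \<open>Obj\<close> are universally quantified and no closure properties of \<open>Obj\<close> are assumed, so a
  monad \<open>M\<close> on the category of all sets, together with a set \<open>A\<close> of interest, is covered by
  any \<open>Obj\<close> that contains \<open>A\<close> and is closed under \<open>M\<close>, such as \<open>{A, M A, M (M A), \<dots>}\<close>.

  The monad is given in extension form (unit and bind).
\<close>

locale set_monad =
  fixes Obj :: "'u set set"
    and M :: "'u set \<Rightarrow> 'u set"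
    and eta :: "'u set \<Rightarrow> 'u \<Rightarrow> 'u"
    and bind :: "'u set \<Rightarrow> 'u set \<Rightarrow> 'u \<Rightarrow> ('u \<Rightarrow> 'u) \<Rightarrow> 'u"
  assumes M_obj: "X \<in> Obj \<Longrightarrow> M X \<in> Obj"
    and eta_in: "\<lbrakk>X \<in> Obj; x \<in> X\<rbrakk> \<Longrightarrow> eta X x \<in> M X"
    and bind_in:
      "\<lbrakk>X \<in> Obj; Y \<in> Obj; m \<in> M X; f \<in> X \<rightarrow>\<^sub>E M Y\<rbrakk> \<Longrightarrow> bind X Y m f \<in> M Y"
    and bind_eta_left:
      "\<lbrakk>X \<in> Obj; Y \<in> Obj; x \<in> X; f \<in> X \<rightarrow>\<^sub>E M Y\<rbrakk> \<Longrightarrow> bind X Y (eta X x) f = f x"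
    and bind_eta_right:
      "\<lbrakk>X \<in> Obj; m \<in> M X\<rbrakk> \<Longrightarrow> bind X X m (\<lambda>x\<in>X. eta X x) = m"
    and bind_assoc:
      "\<lbrakk>X \<in> Obj; Y \<in> Obj; Z \<in> Obj; m \<in> M X; f \<in> X \<rightarrow>\<^sub>E M Y; g \<in> Y \<rightarrow>\<^sub>E M Z\<rbrakk> \<Longrightarrow>
        bind Y Z (bind X Y m f) g = bind X Z m (\<lambda>x\<in>X. bind Y Z (f x) g)"


datatype 'c expr = Var nat | Code 'c | App "'c expr" "'c expr"

text \<open>\<open>exprs n C\<close>: expressions with free variables among \<open>0, \<dots>, n - 1\<close> and codes from \<open>C\<close>.\<close>

inductive_set exprs :: "nat \<Rightarrow> 'c set \<Rightarrow> 'c expr set" for n :: nat and C :: "'c set" where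
  "i < n \<Longrightarrow> Var i \<in> exprs n C"
| "c \<in> C \<Longrightarrow> Code c \<in> exprs n C"
| "\<lbrakk>ef \<in> exprs n C; ea \<in> exprs n C\<rbrakk> \<Longrightarrow> App ef ea \<in> exprs n C"

text \<open>
  \<open>subst c e\<close> is \<open>e[c]\<close>: variable 0 stands for the argument that is supplied first, and the
  remaining variables are shifted down.
\<close>

primrec subst :: "'c \<Rightarrow> 'c expr \<Rightarrow> 'c expr" where
  "subst c (Var i) = (case i of 0 \<Rightarrow> Code c | Suc j \<Rightarrow> Var j)"
| "subst c (Code d) = Code d"
| "subst c (App ef ea) = App (subst c ef) (subst c ea)"

locale monadic_applicative_structure = set_monad Obj M eta bind
  for Obj :: "'u set set" and M eta bind +
  fixes A :: "'u set"
    and app :: "'u \<Rightarrow> 'u \<Rightarrow> 'u"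
  assumes A_obj: "A \<in> Obj"
    and app_in: "\<lbrakk>cf \<in> A; ca \<in> A\<rbrakk> \<Longrightarrow> app cf ca \<in> M A"
begin

text \<open>Only meant for closed expressions; the value on variables is irrelevant.\<close>

primrec eval_expr :: "'u expr \<Rightarrow> 'u" where
  "eval_expr (Var i) = undefined"
| "eval_expr (Code c) = eta A c"
| "eval_expr (App ef ea) =
    bind A A (eval_expr ef) (\<lambda>cf\<in>A. bind A A (eval_expr ea) (\<lambda>ca\<in>A. app cf ca))"

end

text \<open>\<open>lam n e\<close> is the code \<open>\<langle>\<lambda>\<^sup>n. e\<rangle>\<close>, for \<open>e\<close> with \<open>n + 1\<close> free variables.\<close>

locale monadic_combinatory_algebra = monadic_applicative_structure Obj M eta bind A app
  for Obj :: "'u set set" and M eta bind A app +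
  fixes lam :: "nat \<Rightarrow> 'u expr \<Rightarrow> 'u"
  assumes lam_in: "e \<in> exprs (Suc n) A \<Longrightarrow> lam n e \<in> A"
    and app_lam_Suc:
      "\<lbrakk>e \<in> exprs (Suc (Suc n)) A; c \<in> A\<rbrakk> \<Longrightarrow>
        app (lam (Suc n) e) c = eta A (lam n (subst c e))"
    and app_lam_0:
      "\<lbrakk>e \<in> exprs (Suc 0) A; c \<in> A\<rbrakk> \<Longrightarrow> app (lam 0 e) c = eval_expr (subst c e)"


locale complete_heyting_prealgebra =
  fixes Meet :: "'o::preorder set \<Rightarrow> 'o"
    and one :: 'o
    and zero :: 'o
    and imp :: "'o \<Rightarrow> 'o \<Rightarrow> 'o"
  assumes Meet_lower: "x \<in> X \<Longrightarrow> Meet X \<le> x"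
    and Meet_greatest: "(\<And>x. x \<in> X \<Longrightarrow> z \<le> x) \<Longrightarrow> z \<le> Meet X"
    and one_greatest: "x \<le> one"
    and zero_least: "zero \<le> x"
    and imp_adjoint: "Meet {x, y} \<le> z \<longleftrightarrow> x \<le> imp y z"

text \<open>
  \<open>D X m \<phi>\<close> is the modality at \<open>X\<close>.  In the naturality law, the action of \<open>M\<close> on a
  function \<open>f\<close> is expressed through unit and bind.
\<close>

locale monadic_modality =
  set_monad Obj M eta bind + complete_heyting_prealgebra Meet one zero imp
  for Obj :: "'u set set" and M eta bind
    and Meet :: "'o::preorder set \<Rightarrow> 'o" and one zero imp +
  fixes D :: "'u set \<Rightarrow> 'u \<Rightarrow> ('u \<Rightarrow> 'o) \<Rightarrow> 'o"
  assumes natural: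
      "\<lbrakk>X \<in> Obj; Y \<in> Obj; f \<in> X \<rightarrow>\<^sub>E Y; m \<in> M X; \<phi> \<in> Y \<rightarrow>\<^sub>E UNIV\<rbrakk> \<Longrightarrow>
        D Y (bind X Y m (\<lambda>x\<in>X. eta Y (f x))) \<phi> = D X m (\<lambda>x\<in>X. \<phi> (f x))"
    and after_return:
      "\<lbrakk>X \<in> Obj; a \<in> X; \<phi> \<in> X \<rightarrow>\<^sub>E UNIV\<rbrakk> \<Longrightarrow> \<phi> a \<le> D X (eta X a) \<phi>"
    and after_bind:
      "\<lbrakk>X \<in> Obj; Y \<in> Obj; m \<in> M X; f \<in> X \<rightarrow>\<^sub>E M Y; \<phi> \<in> Y \<rightarrow>\<^sub>E UNIV\<rbrakk> \<Longrightarrow>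
        D X m (\<lambda>x\<in>X. D Y (f x) \<phi>) \<le> D Y (bind X Y m f) \<phi>"
    and internal_monotonicity:
      "\<lbrakk>X \<in> Obj; m \<in> M X; \<phi>1 \<in> X \<rightarrow>\<^sub>E UNIV; \<phi>2 \<in> X \<rightarrow>\<^sub>E UNIV\<rbrakk> \<Longrightarrow>
        Meet ((\<lambda>c. imp (\<phi>1 c) (\<phi>2 c)) ` X) \<le> imp (D X m \<phi>1) (D X m \<phi>2)"

text \<open>
  The separator \<open>S\<close> is combinatorially complete in the sense that abstractions of expressions
  all of whose codes lie in \<open>S\<close> are again in \<open>S\<close>.
\<close>

locale monadic_core =
  monadic_combinatory_algebra Obj M eta bind A app lam +
  monadic_modality Obj M eta bind Meet one zero imp D
  for Obj :: "'u set set" and M eta bind A app lam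
    and Meet :: "'o::preorder set \<Rightarrow> 'o" and one zero imp D +
  fixes S :: "'u set"
  assumes S_subset: "S \<subseteq> A"
    and S_complete: "e \<in> exprs (Suc n) S \<Longrightarrow> lam n e \<in> S"
    and S_progress: "\<lbrakk>cf \<in> S; ca \<in> S\<rbrakk> \<Longrightarrow> D A (app cf ca) (\<lambda>r\<in>A. zero) \<le> zero"

definition core_evidence ::
    "'u set \<Rightarrow> ('u \<Rightarrow> 'u \<Rightarrow> 'u) \<Rightarrow> ('u set \<Rightarrow> 'u \<Rightarrow> ('u \<Rightarrow> 'o::preorder) \<Rightarrow> 'o) \<Rightarrow>
      ('u \<Rightarrow> 'o) \<Rightarrow> 'u \<Rightarrow> ('u \<Rightarrow> 'o) \<Rightarrow> bool" where
  "core_evidence A app D \<phi>1 e \<phi>2 \<longleftrightarrow> (\<forall>c\<in>A. \<phi>1 c \<le> D A (app e c) \<phi>2)"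


text \<open>
  Evidenced frames, with propositions \<open>P\<close>, evidence \<open>E\<close> and \<open>R \<phi>1 e \<phi>2\<close> for
  \<open>\<phi>1 \<midarrow>e\<rightarrow> \<phi>2\<close>.  Evidence is always chosen uniformly in the propositions.
\<close>

definition ef_top :: "'p set \<Rightarrow> 'e set \<Rightarrow> ('p \<Rightarrow> 'e \<Rightarrow> 'p \<Rightarrow> bool) \<Rightarrow> 'p \<Rightarrow> bool" where
  "ef_top P E R t \<longleftrightarrow> t \<in> P \<and> (\<exists>etop\<in>E. \<forall>\<phi>\<in>P. R \<phi> etop t)"

definition ef_conj ::
    "'p set \<Rightarrow> 'e set \<Rightarrow> ('p \<Rightarrow> 'e \<Rightarrow> 'p \<Rightarrow> bool) \<Rightarrow> ('p \<Rightarrow> 'p \<Rightarrow> 'p) \<Rightarrow> bool" where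
  "ef_conj P E R cnj \<longleftrightarrow>
    (\<forall>\<phi>1\<in>P. \<forall>\<phi>2\<in>P. cnj \<phi>1 \<phi>2 \<in> P) \<and>
    (\<exists>efst\<in>E. \<forall>\<phi>1\<in>P. \<forall>\<phi>2\<in>P. R (cnj \<phi>1 \<phi>2) efst \<phi>1) \<and>
    (\<exists>esnd\<in>E. \<forall>\<phi>1\<in>P. \<forall>\<phi>2\<in>P. R (cnj \<phi>1 \<phi>2) esnd \<phi>2) \<and>
    (\<exists>pair. \<forall>e1\<in>E. \<forall>e2\<in>E. pair e1 e2 \<in> E \<and>
      (\<forall>\<phi>\<in>P. \<forall>\<phi>1\<in>P. \<forall>\<phi>2\<in>P.
        R \<phi> e1 \<phi>1 \<and> R \<phi> e2 \<phi>2 \<longrightarrow> R \<phi> (pair e1 e2) (cnj \<phi>1 \<phi>2)))"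

definition ef_univ_imp ::
    "'p set \<Rightarrow> 'e set \<Rightarrow> ('p \<Rightarrow> 'e \<Rightarrow> 'p \<Rightarrow> bool) \<Rightarrow> ('p \<Rightarrow> 'p \<Rightarrow> 'p) \<Rightarrow>
      ('p \<Rightarrow> 'p set \<Rightarrow> 'p) \<Rightarrow> bool" where
  "ef_univ_imp P E R cnj uimp \<longleftrightarrow>
    (\<forall>\<phi>\<in>P. \<forall>\<Psi>\<subseteq>P. uimp \<phi> \<Psi> \<in> P) \<and>
    (\<exists>cur. \<forall>e\<in>E. cur e \<in> E \<and>
      (\<forall>\<phi>1\<in>P. \<forall>\<phi>2\<in>P. \<forall>\<Psi>\<subseteq>P.
        (\<forall>\<psi>\<in>\<Psi>. R (cnj \<phi>1 \<phi>2) e \<psi>) \<longrightarrow> R \<phi>1 (cur e) (uimp \<phi>2 \<Psi>))) \<and>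
    (\<exists>eeval\<in>E. \<forall>\<phi>\<in>P. \<forall>\<Psi>\<subseteq>P. \<forall>\<psi>\<in>\<Psi>. R (cnj (uimp \<phi> \<Psi>) \<phi>) eeval \<psi>)"

definition evidenced_frame ::
    "'p set \<Rightarrow> 'e set \<Rightarrow> ('p \<Rightarrow> 'e \<Rightarrow> 'p \<Rightarrow> bool) \<Rightarrow> bool" where
  "evidenced_frame P E R \<longleftrightarrow>
    (\<exists>eid\<in>E. \<forall>\<phi>\<in>P. R \<phi> eid \<phi>) \<and>
    (\<exists>comp. \<forall>e1\<in>E. \<forall>e2\<in>E. comp e1 e2 \<in> E \<and>
      (\<forall>\<phi>1\<in>P. \<forall>\<phi>2\<in>P. \<forall>\<phi>3\<in>P.
        R \<phi>1 e1 \<phi>2 \<and> R \<phi>2 e2 \<phi>3 \<longrightarrow> R \<phi>1 (comp e1 e2) \<phi>3)) \<and>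
    (\<exists>t. ef_top P E R t) \<and>
    (\<exists>cnj. ef_conj P E R cnj \<and> (\<exists>uimp. ef_univ_imp P E R cnj uimp))"

end

theory Submission
  imports Defs
begin

text \<open>
  Take \<open>(\<phi>1 \<and> \<phi>2)(c) = \<Diamond>(c \<cdot> tt)(\<phi>1) \<sqinter> \<Diamond>(c \<cdot> ff)(\<phi>2)\<close>, with \<open>tt\<close> and \<open>ff\<close> the
  Church booleans, and \<open>(\<phi> \<supset> \<Psi>)(c) = \<Sqinter>a. \<Sqinter>\<psi>\<in>\<Psi>. \<phi>(a) \<Rightarrow> \<Diamond>(c \<cdot> a)(\<psi>)\<close>.  The modality need not
  preserve binary meets.  Since a conjunction carries one computation per component and
  not a computation of a pair, pairing does not need this; for the evaluation evidence,
  internal monotonicity lets the hypothesis \<open>\<Diamond>(p \<cdot> ff)(\<phi>)\<close> be used under \<open>\<Diamond>(p \<cdot> tt)\<close>.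
\<close>

section \<open>Expressions, adjunction rules and call-by-value evaluation\<close>

lemma Var_in_exprs_iff [simp]: "Var i \<in> exprs n C \<longleftrightarrow> i < n"
  by (auto intro: exprs.intros elim: exprs.cases)

lemma Code_in_exprs_iff [simp]: "Code c \<in> exprs n C \<longleftrightarrow> c \<in> C"
  by (auto intro: exprs.intros elim: exprs.cases)

lemma App_in_exprs_iff [simp]:
  "App ef ea \<in> exprs n C \<longleftrightarrow> ef \<in> exprs n C \<and> ea \<in> exprs n C"
  by (auto intro: exprs.intros elim: exprs.cases)

context complete_heyting_prealgebra
begin

lemma le_Meet_pair: "z \<le> x \<Longrightarrow> z \<le> y \<Longrightarrow> z \<le> Meet {x, y}"
  by (rule Meet_greatest) auto

lemma Meet_pair_le1: "Meet {x, y} \<le> x"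
  by (rule Meet_lower) simp

lemma Meet_pair_le2: "Meet {x, y} \<le> y"
  by (rule Meet_lower) simp

lemma le_impI: "Meet {x, y} \<le> z \<Longrightarrow> x \<le> imp y z"
  by (simp add: imp_adjoint)

text \<open>Modus ponens below a common lower bound: \<open>w\<close> lies below the meet of
  \<open>x\<close> and \<open>y\<close>, and the adjunction applies.\<close>

lemma le_impD:
  assumes "x \<le> imp y z" and "w \<le> x" and "w \<le> y"
  shows "w \<le> z"
  by (meson assms imp_adjoint le_Meet_pair order_trans)

end

context monadic_applicative_structure
begin

lemma eval_expr_in: "e \<in> exprs 0 A \<Longrightarrow> eval_expr e \<in> M A"
proof (induction e)
  case (App ef ea)
  then show ?case
    by (auto intro!: bind_in A_obj app_in)
qed (auto intro: eta_in A_obj)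

text \<open>The left unit law removes the outer bind once the operator is a returned value; the
  operand may still have effects.\<close>

lemma eval_expr_App_value:
  assumes "eval_expr ef = eta A f" and "f \<in> A" and "e \<in> exprs 0 A"
  shows "eval_expr (App ef e) = bind A A (eval_expr e) (\<lambda>a\<in>A. app f a)"
proof -
  \<comment> \<open>The left unit law is available only for continuations in the extensional
    function space.\<close>
  have "(\<lambda>cf\<in>A. bind A A (eval_expr e) (\<lambda>ca\<in>A. app cf ca)) \<in> A \<rightarrow>\<^sub>E M A"
    using assms(3) by (auto intro!: bind_in A_obj app_in eval_expr_in)
  then show ?thesis
    using assms(1,2) by (simp add: bind_eta_left A_obj)
qed

lemma eval_expr_App_values:
  assumes "eval_expr ef = eta A f" and "f \<in> A"
    and "eval_expr e = eta A a" and "a \<in> A" and "e \<in> exprs 0 A"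
  shows "eval_expr (App ef e) = app f a"
proof -
  have "(\<lambda>ca\<in>A. app f ca) \<in> A \<rightarrow>\<^sub>E M A"
    using assms(2) by (auto intro!: app_in)
  with assms show ?thesis
    by (simp only: eval_expr_App_value) (simp add: bind_eta_left A_obj)
qed

lemma eval_expr_App_Codes:
  "f \<in> A \<Longrightarrow> a \<in> A \<Longrightarrow> eval_expr (App (Code f) (Code a)) = app f a"
  by (rule eval_expr_App_values) auto

end

context monadic_modality
begin

text \<open>By adjunction \<open>w\<close> lies below the meet of all the implications, so modus
  ponens applies below \<open>w\<close>. The context \<open>w\<close> makes facts known outside the
  modality usable inside it.\<close>

lemma modality_internal_mono:
  assumes "X \<in> Obj" and "m \<in> M X" and "\<phi>1 \<in> X \<rightarrow>\<^sub>E UNIV" and "\<phi>2 \<in> X \<rightarrow>\<^sub>E UNIV"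
    and "\<And>c. c \<in> X \<Longrightarrow> Meet {w, \<phi>1 c} \<le> \<phi>2 c"
    and "w \<le> D X m \<phi>1"
  shows "w \<le> D X m \<phi>2"
proof (rule le_impD)
  show "Meet ((\<lambda>c. imp (\<phi>1 c) (\<phi>2 c)) ` X) \<le> imp (D X m \<phi>1) (D X m \<phi>2)"
    by (rule internal_monotonicity) fact+
  show "w \<le> Meet ((\<lambda>c. imp (\<phi>1 c) (\<phi>2 c)) ` X)"
    using assms(5) by (auto intro!: Meet_greatest le_impI)
qed fact

end

context monadic_core
begin

section \<open>Church booleans and pairs\<close>

lemma in_A: "c \<in> S \<Longrightarrow> c \<in> A"
  using S_subset by blast

text \<open>\<open>lam (Suc 0)\<close> abstracts two variables, and index 0 is the argument supplied
  first; hence \<open>tt\<close> selects the first of two arguments and \<open>ff\<close> the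
  second.\<close>

definition tt :: 'u where
  "tt = lam (Suc 0) (Var 0)"

definition ff :: 'u where
  "ff = lam (Suc 0) (Var (Suc 0))"

text \<open>The two components are supplied first, as variables 0 and 1; the selector comes last, as
  variable 2.\<close>

definition pair_code :: 'u where
  "pair_code = lam (Suc (Suc 0)) (App (App (Var (Suc (Suc 0))) (Var 0)) (Var (Suc 0)))"

text \<open>The closure that \<open>pair_code\<close> returns after both components, which range
  over all of \<open>A\<close> and not only over \<open>S\<close>.\<close>

definition pair_of :: "'u \<Rightarrow> 'u \<Rightarrow> 'u" where
  "pair_of a b = lam 0 (App (App (Var 0) (Code a)) (Code b))"

lemma combinators_in_S: "tt \<in> S" "ff \<in> S" "pair_code \<in> S"
  by (auto simp: tt_def ff_def pair_code_def intro!: S_complete)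

lemmas combinators_in_A [simp] = combinators_in_S [THEN in_A]

lemma pair_of_in [simp]: "a \<in> A \<Longrightarrow> b \<in> A \<Longrightarrow> pair_of a b \<in> A"
  by (auto simp: pair_of_def intro!: lam_in)

lemma eval_expr_tt:
  assumes "a \<in> A" and "b \<in> A"
  shows "eval_expr (App (App (Code tt) (Code a)) (Code b)) = eta A a"
proof -
  \<comment> \<open>The first argument replaces variable 0, which leaves a constant
    function.\<close>
  have "eval_expr (App (Code tt) (Code a)) = eta A (lam 0 (Code a))"
    using assms by (simp only: eval_expr_App_Codes combinators_in_A) (simp add: tt_def app_lam_Suc)
  then have "eval_expr (App (App (Code tt) (Code a)) (Code b)) = app (lam 0 (Code a)) b"
    using assms by (intro eval_expr_App_values) (auto intro: lam_in)
  then show ?thesis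
    using assms by (simp add: app_lam_0)
qed

lemma eval_expr_ff:
  assumes "a \<in> A" and "b \<in> A"
  shows "eval_expr (App (App (Code ff) (Code a)) (Code b)) = eta A b"
proof -
  \<comment> \<open>The first argument is discarded and variable 1 shifts down to 0, which leaves
    the identity.\<close>
  have "eval_expr (App (Code ff) (Code a)) = eta A (lam 0 (Var 0))"
    using assms by (simp only: eval_expr_App_Codes combinators_in_A) (simp add: ff_def app_lam_Suc)
  then have "eval_expr (App (App (Code ff) (Code a)) (Code b)) = app (lam 0 (Var 0)) b"
    using assms by (intro eval_expr_App_values) (auto intro: lam_in)
  then show ?thesis
    using assms by (simp add: app_lam_0)
qed

lemma app_pair_of:
  assumes "a \<in> A" and "b \<in> A"
  shows "app (pair_of a b) tt = eta A a" and "app (pair_of a b) ff = eta A b"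
proof -
  have *: "app (pair_of a b) c = eval_expr (App (App (Code c) (Code a)) (Code b))"
    if "c \<in> A" for c
    using assms that by (simp add: pair_of_def app_lam_0 del: eval_expr.simps)
  show "app (pair_of a b) tt = eta A a"
    using assms by (simp only: * eval_expr_tt combinators_in_A)
  show "app (pair_of a b) ff = eta A b"
    using assms by (simp only: * eval_expr_ff combinators_in_A)
qed

lemma eval_expr_pair_code:
  assumes "a \<in> A" and "b \<in> A"
  shows "eval_expr (App (App (Code pair_code) (Code a)) (Code b)) = eta A (pair_of a b)"
proof -
  \<comment> \<open>\<open>pair_code\<close> after its first component: the second component has
    become variable 0 and the selector variable 1.\<close>
  let ?f = "lam (Suc 0) (App (App (Var (Suc 0)) (Code a)) (Var 0))"
  have "eval_expr (App (Code pair_code) (Code a)) = eta A ?f"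
    using assms
    by (simp only: eval_expr_App_Codes combinators_in_A) (simp add: pair_code_def app_lam_Suc)
  then have "eval_expr (App (App (Code pair_code) (Code a)) (Code b)) = app ?f b"
    using assms by (intro eval_expr_App_values) (auto intro: lam_in)
  then show ?thesis
    using assms by (simp add: app_lam_Suc pair_of_def)
qed

section \<open>Evidence and sequencing under the modality\<close>

abbreviation preds :: "('u \<Rightarrow> 'o) set" where
  "preds \<equiv> A \<rightarrow>\<^sub>E UNIV"

abbreviation evid :: "('u \<Rightarrow> 'o) \<Rightarrow> 'u \<Rightarrow> ('u \<Rightarrow> 'o) \<Rightarrow> bool" where
  "evid \<equiv> core_evidence A app D"

lemma evidI: "(\<And>c. c \<in> A \<Longrightarrow> \<phi>1 c \<le> D A (app e c) \<phi>2) \<Longrightarrow> evid \<phi>1 e \<phi>2"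
  by (simp add: core_evidence_def)

lemma evidD: "evid \<phi>1 e \<phi>2 \<Longrightarrow> c \<in> A \<Longrightarrow> \<phi>1 c \<le> D A (app e c) \<phi>2"
  by (simp add: core_evidence_def)

lemma le_after_return:
  assumes "w \<le> \<phi> a" and "a \<in> A" and "\<phi> \<in> preds"
  shows "w \<le> D A (eta A a) \<phi>"
  using assms after_return[OF A_obj] order_trans by blast

text \<open>The sequencing rule, from internal monotonicity and After-Bind: \<open>\<phi>'\<close>
  is the assertion between the two computations, and the context \<open>w\<close> stays available
  for the second one.\<close>

lemma le_after_bind:
  assumes "m \<in> M A" and "\<And>x. x \<in> A \<Longrightarrow> f x \<in> M A" and "\<phi> \<in> preds" and "\<phi>' \<in> preds"
    and "w \<le> D A m \<phi>'"
    and "\<And>x. x \<in> A \<Longrightarrow> Meet {w, \<phi>' x} \<le> D A (f x) \<phi>"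
  shows "w \<le> D A (bind A A m (\<lambda>x\<in>A. f x)) \<phi>"
proof -
  \<comment> \<open>The restricted function is kept as an applied term because After-Bind is stated
    for extensional continuations.\<close>
  have "w \<le> D A m (\<lambda>x\<in>A. D A ((\<lambda>x\<in>A. f x) x) \<phi>)"
    by (rule modality_internal_mono[OF A_obj, where ?\<phi>1.0 = \<phi>']) (use assms in auto)
  also have "\<dots> \<le> D A (bind A A m (\<lambda>x\<in>A. f x)) \<phi>"
    using assms(1-3) by (intro after_bind A_obj) auto
  finally show ?thesis .
qed

section \<open>Identity, composition and top\<close>

definition id_code :: 'u where
  "id_code = lam 0 (Var 0)"

lemma id_code_in: "id_code \<in> S"
  by (simp add: id_code_def S_complete)

lemma app_id_code: "c \<in> A \<Longrightarrow> app id_code c = eta A c"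
  by (simp add: id_code_def app_lam_0)

lemma evid_id: "\<phi> \<in> preds \<Longrightarrow> evid \<phi> id_code \<phi>"
  by (auto simp: app_id_code intro!: evidI le_after_return)

definition comp_code :: "'u \<Rightarrow> 'u \<Rightarrow> 'u" where
  "comp_code e1 e2 = lam 0 (App (Code e2) (App (Code e1) (Var 0)))"

lemma comp_code_in: "e1 \<in> S \<Longrightarrow> e2 \<in> S \<Longrightarrow> comp_code e1 e2 \<in> S"
  by (simp add: comp_code_def S_complete)

lemma app_comp_code:
  assumes "e1 \<in> A" and "e2 \<in> A" and "c \<in> A"
  shows "app (comp_code e1 e2) c = bind A A (app e1 c) (\<lambda>a\<in>A. app e2 a)"
proof -
  have "app (comp_code e1 e2) c = eval_expr (App (Code e2) (App (Code e1) (Code c)))"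
    using assms by (simp add: comp_code_def app_lam_0 del: eval_expr.simps)
  also have "\<dots> = bind A A (eval_expr (App (Code e1) (Code c))) (\<lambda>a\<in>A. app e2 a)"
    using assms by (intro eval_expr_App_value) auto
  finally show ?thesis
    using assms by (simp only: eval_expr_App_Codes)
qed

lemma evid_comp:
  assumes "e1 \<in> A" and "e2 \<in> A" and "\<phi>2 \<in> preds" and "\<phi>3 \<in> preds"
    and "evid \<phi>1 e1 \<phi>2" and "evid \<phi>2 e2 \<phi>3"
  shows "evid \<phi>1 (comp_code e1 e2) \<phi>3"
proof (rule evidI)
  fix c
  assume c: "c \<in> A"
  \<comment> \<open>The intermediate assertion is \<open>\<phi>2\<close>; it alone justifies running
    \<open>e2\<close>, so the context \<open>\<phi>1 c\<close> is dropped.\<close>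
  have "\<phi>1 c \<le> D A (bind A A (app e1 c) (\<lambda>a\<in>A. app e2 a)) \<phi>3"
    using assms c
    by (intro le_after_bind[where \<phi>' = \<phi>2])
      (auto intro: app_in evidD order_trans[OF Meet_pair_le2])
  then show "\<phi>1 c \<le> D A (app (comp_code e1 e2) c) \<phi>3"
    using assms c by (simp only: app_comp_code)
qed

text \<open>The identity code serves as evidence: it returns its argument, where the predicate has
  the value \<open>one\<close>.\<close>

lemma ef_top_core: "ef_top preds S evid (\<lambda>c\<in>A. one)"
  unfolding ef_top_def
  by (auto simp: app_id_code one_greatest
      intro!: bexI[OF _ id_code_in] evidI le_after_return)

section \<open>Conjunction\<close>

definition conj_pred :: "('u \<Rightarrow> 'o) \<Rightarrow> ('u \<Rightarrow> 'o) \<Rightarrow> 'u \<Rightarrow> 'o" where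
  "conj_pred \<phi>1 \<phi>2 = (\<lambda>c\<in>A. Meet {D A (app c tt) \<phi>1, D A (app c ff) \<phi>2})"

lemma conj_pred_in [simp]: "conj_pred \<phi>1 \<phi>2 \<in> preds"
  by (simp add: conj_pred_def)

lemma conj_pred_le:
  assumes "c \<in> A"
  shows "conj_pred \<phi>1 \<phi>2 c \<le> D A (app c tt) \<phi>1" "conj_pred \<phi>1 \<phi>2 c \<le> D A (app c ff) \<phi>2"
  using assms by (simp_all add: conj_pred_def Meet_pair_le1 Meet_pair_le2)

lemma le_conj_pred:
  assumes "c \<in> A" and "w \<le> D A (app c tt) \<phi>1" and "w \<le> D A (app c ff) \<phi>2"
  shows "w \<le> conj_pred \<phi>1 \<phi>2 c"
  using assms by (simp add: conj_pred_def le_Meet_pair)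

text \<open>With \<open>tt\<close> or \<open>ff\<close> for \<open>d\<close> this is the evidence
  for a projection: running it on \<open>c\<close> is the very computation that
  \<open>conj_pred\<close> speaks of.\<close>

definition apply_to_code :: "'u \<Rightarrow> 'u" where
  "apply_to_code d = lam 0 (App (Var 0) (Code d))"

lemma apply_to_code_in: "d \<in> S \<Longrightarrow> apply_to_code d \<in> S"
  by (simp add: apply_to_code_def S_complete)

lemma app_apply_to_code:
  assumes "d \<in> A" and "c \<in> A"
  shows "app (apply_to_code d) c = app c d"
proof -
  have "app (apply_to_code d) c = eval_expr (App (Code c) (Code d))"
    using assms by (simp add: apply_to_code_def app_lam_0 del: eval_expr.simps)
  then show ?thesis
    using assms by (simp only: eval_expr_App_Codes)
qed

text \<open>The Church boolean \<open>b\<close> selects \<open>e1\<close> or \<open>e2\<close> before either is applied to \<open>c\<close>.\<close>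

definition pairing_body :: "'u \<Rightarrow> 'u \<Rightarrow> 'u \<Rightarrow> 'u" where
  "pairing_body e1 e2 c = lam 0 (App (App (App (Var 0) (Code e1)) (Code e2)) (Code c))"

definition pairing_code :: "'u \<Rightarrow> 'u \<Rightarrow> 'u" where
  "pairing_code e1 e2 =
    lam (Suc 0) (App (App (App (Var (Suc 0)) (Code e1)) (Code e2)) (Var 0))"

lemma pairing_code_in: "e1 \<in> S \<Longrightarrow> e2 \<in> S \<Longrightarrow> pairing_code e1 e2 \<in> S"
  by (simp add: pairing_code_def S_complete)

lemma pairing_body_in:
  "e1 \<in> A \<Longrightarrow> e2 \<in> A \<Longrightarrow> c \<in> A \<Longrightarrow> pairing_body e1 e2 c \<in> A"
  by (simp add: pairing_body_def lam_in)

lemma app_pairing_code: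
  assumes "e1 \<in> A" and "e2 \<in> A" and "c \<in> A"
  shows "app (pairing_code e1 e2) c = eta A (pairing_body e1 e2 c)"
  using assms by (simp add: pairing_code_def pairing_body_def app_lam_Suc)

lemma app_pairing_body:
  assumes "e1 \<in> A" and "e2 \<in> A" and "c \<in> A"
  shows "app (pairing_body e1 e2 c) tt = app e1 c" "app (pairing_body e1 e2 c) ff = app e2 c"
proof -
  have *: "app (pairing_body e1 e2 c) b =
      eval_expr (App (App (App (Code b) (Code e1)) (Code e2)) (Code c))" if "b \<in> A" for b
    using assms that by (simp add: pairing_body_def app_lam_0 del: eval_expr.simps)
  have "eval_expr (App (App (App (Code tt) (Code e1)) (Code e2)) (Code c)) = app e1 c"
    using assms by (intro eval_expr_App_values eval_expr_tt) auto
  then show "app (pairing_body e1 e2 c) tt = app e1 c"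
    by (simp only: * combinators_in_A)
  have "eval_expr (App (App (App (Code ff) (Code e1)) (Code e2)) (Code c)) = app e2 c"
    using assms by (intro eval_expr_App_values eval_expr_ff) auto
  then show "app (pairing_body e1 e2 c) ff = app e2 c"
    by (simp only: * combinators_in_A)
qed

text \<open>Supplying \<open>c\<close> returns a closure, so After-Return applies; probing that
  closure with \<open>tt\<close> or \<open>ff\<close> runs \<open>e1\<close> or \<open>e2\<close> on
  \<open>c\<close>, and the two hypotheses are exactly the required components.\<close>

lemma evid_pairing:
  assumes "e1 \<in> A" and "e2 \<in> A" and "evid \<phi> e1 \<phi>1" and "evid \<phi> e2 \<phi>2"
  shows "evid \<phi> (pairing_code e1 e2) (conj_pred \<phi>1 \<phi>2)"
  using assms
  by (intro evidI)
    (simp add: app_pairing_code app_pairing_body pairing_body_in le_after_return le_conj_pred evidD)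

lemma ef_conj_core: "ef_conj preds S evid conj_pred"
  unfolding ef_conj_def
proof (intro conjI)
  show "\<exists>efst\<in>S. \<forall>\<phi>1\<in>preds. \<forall>\<phi>2\<in>preds. evid (conj_pred \<phi>1 \<phi>2) efst \<phi>1"
    by (auto intro!: bexI[OF _ apply_to_code_in[OF combinators_in_S(1)]] evidI
        simp: app_apply_to_code conj_pred_le)
  show "\<exists>esnd\<in>S. \<forall>\<phi>1\<in>preds. \<forall>\<phi>2\<in>preds. evid (conj_pred \<phi>1 \<phi>2) esnd \<phi>2"
    by (auto intro!: bexI[OF _ apply_to_code_in[OF combinators_in_S(2)]] evidI
        simp: app_apply_to_code conj_pred_le)
  show "\<exists>pair. \<forall>e1\<in>S. \<forall>e2\<in>S. pair e1 e2 \<in> S \<and>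
      (\<forall>\<phi>\<in>preds. \<forall>\<phi>1\<in>preds. \<forall>\<phi>2\<in>preds.
        evid \<phi> e1 \<phi>1 \<and> evid \<phi> e2 \<phi>2 \<longrightarrow> evid \<phi> (pair e1 e2) (conj_pred \<phi>1 \<phi>2))"
    by (rule exI[of _ pairing_code]) (simp add: pairing_code_in evid_pairing in_A)
qed simp

section \<open>Universal implication\<close>

definition uimp_pred :: "('u \<Rightarrow> 'o) \<Rightarrow> ('u \<Rightarrow> 'o) set \<Rightarrow> 'u \<Rightarrow> 'o" where
  "uimp_pred \<phi> \<Psi> = (\<lambda>c\<in>A. Meet {imp (\<phi> a) (D A (app c a) \<psi>) | a \<psi>. a \<in> A \<and> \<psi> \<in> \<Psi>})"

lemma uimp_pred_in [simp]: "uimp_pred \<phi> \<Psi> \<in> preds"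
  by (simp add: uimp_pred_def)

lemma uimp_pred_le:
  assumes "c \<in> A" and "a \<in> A" and "\<psi> \<in> \<Psi>"
  shows "uimp_pred \<phi> \<Psi> c \<le> imp (\<phi> a) (D A (app c a) \<psi>)"
  using assms by (auto simp: uimp_pred_def intro!: Meet_lower)

lemma le_uimp_pred:
  assumes "c \<in> A"
    and "\<And>a \<psi>. a \<in> A \<Longrightarrow> \<psi> \<in> \<Psi> \<Longrightarrow> Meet {w, \<phi> a} \<le> D A (app c a) \<psi>"
  shows "w \<le> uimp_pred \<phi> \<Psi> c"
  using assms by (auto simp: uimp_pred_def intro!: Meet_greatest le_impI)

definition curry_body :: "'u \<Rightarrow> 'u \<Rightarrow> 'u" where
  "curry_body e c = lam 0 (App (Code e) (App (App (Code pair_code) (Code c)) (Var 0)))"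

text \<open>Abstracting two variables makes the first application a mere return of
  \<open>curry_body e c\<close>, the code at which the implication then has to hold.\<close>

definition curry_code :: "'u \<Rightarrow> 'u" where
  "curry_code e =
    lam (Suc 0) (App (Code e) (App (App (Code pair_code) (Var 0)) (Var (Suc 0))))"

lemma curry_code_in: "e \<in> S \<Longrightarrow> curry_code e \<in> S"
  by (simp add: curry_code_def S_complete combinators_in_S)

lemma curry_body_in: "e \<in> A \<Longrightarrow> c \<in> A \<Longrightarrow> curry_body e c \<in> A"
  by (simp add: curry_body_def lam_in)

lemma app_curry_code:
  "e \<in> A \<Longrightarrow> c \<in> A \<Longrightarrow> app (curry_code e) c = eta A (curry_body e c)"
  by (simp add: curry_code_def curry_body_def app_lam_Suc)

lemma app_curry_body:
  assumes "e \<in> A" and "c \<in> A" and "a \<in> A"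
  shows "app (curry_body e c) a = app e (pair_of c a)"
proof -
  have "app (curry_body e c) a =
      eval_expr (App (Code e) (App (App (Code pair_code) (Code c)) (Code a)))"
    using assms by (simp add: curry_body_def app_lam_0 del: eval_expr.simps)
  also have "\<dots> = app e (pair_of c a)"
    using assms by (intro eval_expr_App_values eval_expr_pair_code) auto
  finally show ?thesis .
qed

text \<open>Connects the conjunction, which speaks of computations, with pairs of values: probing
  such a pair returns a component, so After-Return suffices. Currying runs \<open>e\<close> on a
  pair of this kind.\<close>

lemma le_conj_pred_pair_of:
  assumes "a \<in> A" and "b \<in> A" and "\<phi>1 \<in> preds" and "\<phi>2 \<in> preds"
  shows "Meet {\<phi>1 a, \<phi>2 b} \<le> conj_pred \<phi>1 \<phi>2 (pair_of a b)"
  using assms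
  by (auto simp: app_pair_of Meet_pair_le1 Meet_pair_le2 intro!: le_conj_pred le_after_return)

lemma evid_curry:
  assumes "e \<in> A" and "\<phi>1 \<in> preds" and "\<phi>2 \<in> preds"
    and "\<And>\<psi>. \<psi> \<in> \<Psi> \<Longrightarrow> evid (conj_pred \<phi>1 \<phi>2) e \<psi>"
  shows "evid \<phi>1 (curry_code e) (uimp_pred \<phi>2 \<Psi>)"
proof (rule evidI)
  fix c
  assume c: "c \<in> A"
  have "\<phi>1 c \<le> uimp_pred \<phi>2 \<Psi> (curry_body e c)"
  proof (rule le_uimp_pred)
    fix a \<psi>
    assume a: "a \<in> A" and \<psi>: "\<psi> \<in> \<Psi>"
    have "Meet {\<phi>1 c, \<phi>2 a} \<le> conj_pred \<phi>1 \<phi>2 (pair_of c a)"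
      using assms c a by (simp add: le_conj_pred_pair_of)
    also have "\<dots> \<le> D A (app e (pair_of c a)) \<psi>"
      using assms(4)[OF \<psi>] c a by (simp add: evidD)
    finally show "Meet {\<phi>1 c, \<phi>2 a} \<le> D A (app (curry_body e c) a) \<psi>"
      using assms(1) c a by (simp add: app_curry_body)
  qed (use assms(1) c in \<open>simp add: curry_body_in\<close>)
  then show "\<phi>1 c \<le> D A (app (curry_code e) c) (uimp_pred \<phi>2 \<Psi>)"
    using assms(1) c by (simp add: app_curry_code curry_body_in le_after_return)
qed

text \<open>The argument is probed twice: with \<open>tt\<close> for the function, then with
  \<open>ff\<close> for its argument.\<close>

definition eval_code :: 'u where
  "eval_code = lam 0 (App (App (Var 0) (Code tt)) (App (Var 0) (Code ff)))"

lemma eval_code_in: "eval_code \<in> S"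
  by (simp add: eval_code_def S_complete combinators_in_S)

lemma app_eval_code:
  assumes "c \<in> A"
  shows "app eval_code c =
    bind A A (app c tt) (\<lambda>f\<in>A. bind A A (app c ff) (\<lambda>a\<in>A. app f a))"
proof -
  have "app eval_code c =
      eval_expr (App (App (Code c) (Code tt)) (App (Code c) (Code ff)))"
    using assms by (simp add: eval_code_def app_lam_0 del: eval_expr.simps)
  \<comment> \<open>Both probes may have effects, so neither bind collapses by a unit law.\<close>
  also have "\<dots> = bind A A (eval_expr (App (Code c) (Code tt)))
      (\<lambda>f\<in>A. bind A A (eval_expr (App (Code c) (Code ff))) (\<lambda>a\<in>A. app f a))"
    by (rule eval_expr.simps)
  finally show ?thesis
    using assms by (simp only: eval_expr_App_Codes combinators_in_A)
qed

text \<open>The sequencing rule is applied once per bind, with the implication at \<open>f\<close>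
  and then \<open>\<phi>\<close> as intermediate assertions.\<close>

lemma evid_eval:
  assumes "\<phi> \<in> preds" and "\<psi> \<in> preds" and "\<psi> \<in> \<Psi>"
  shows "evid (conj_pred (uimp_pred \<phi> \<Psi>) \<phi>) eval_code \<psi>"
proof (rule evidI)
  fix c
  assume c: "c \<in> A"
  let ?w = "conj_pred (uimp_pred \<phi> \<Psi>) \<phi> c"
  have "?w \<le> D A (bind A A (app c tt) (\<lambda>f\<in>A. bind A A (app c ff) (\<lambda>a\<in>A. app f a))) \<psi>"
  proof (rule le_after_bind)
    show "?w \<le> D A (app c tt) (uimp_pred \<phi> \<Psi>)"
      using c by (rule conj_pred_le)
    fix f
    assume f: "f \<in> A"
    show "bind A A (app c ff) (\<lambda>a\<in>A. app f a) \<in> M A"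
      using c f by (auto intro!: bind_in A_obj app_in)
    let ?v = "Meet {?w, uimp_pred \<phi> \<Psi> f}"
    show "?v \<le> D A (bind A A (app c ff) (\<lambda>a\<in>A. app f a)) \<psi>"
    proof (rule le_after_bind)
      \<comment> \<open>The second half of the conjunction is still at hand after the first probe
        because \<open>?w\<close> was kept in the context.\<close>
      show "?v \<le> D A (app c ff) \<phi>"
        using conj_pred_le(2)[OF c] by (rule order_trans[OF Meet_pair_le1])
      fix a
      assume a: "a \<in> A"
      \<comment> \<open>The context now contains both the implication at \<open>f\<close> and its
        premise at \<open>a\<close>, so modus ponens concludes.\<close>
      show "Meet {?v, \<phi> a} \<le> D A (app f a) \<psi>"
        by (rule le_impD[OF uimp_pred_le[OF f a assms(3)]])
          (blast intro: order_trans Meet_pair_le1 Meet_pair_le2)+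
    qed (use assms c f in \<open>auto intro: app_in\<close>)
  qed (use assms c in \<open>auto intro: app_in\<close>)
  then show "?w \<le> D A (app eval_code c) \<psi>"
    using c by (simp only: app_eval_code)
qed

lemma ef_univ_imp_core: "ef_univ_imp preds S evid conj_pred uimp_pred"
  unfolding ef_univ_imp_def
proof (intro conjI)
  show "\<exists>cur. \<forall>e\<in>S. cur e \<in> S \<and>
      (\<forall>\<phi>1\<in>preds. \<forall>\<phi>2\<in>preds. \<forall>\<Psi>\<subseteq>preds.
        (\<forall>\<psi>\<in>\<Psi>. evid (conj_pred \<phi>1 \<phi>2) e \<psi>) \<longrightarrow> evid \<phi>1 (cur e) (uimp_pred \<phi>2 \<Psi>))"
    by (rule exI[of _ curry_code]) (simp add: curry_code_in evid_curry in_A)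
  show "\<exists>eeval\<in>S. \<forall>\<phi>\<in>preds. \<forall>\<Psi>\<subseteq>preds. \<forall>\<psi>\<in>\<Psi>.
      evid (conj_pred (uimp_pred \<phi> \<Psi>) \<phi>) eeval \<psi>"
    by (intro bexI[OF _ eval_code_in] ballI allI impI evid_eval) auto
qed simp

section \<open>Assembling the evidenced frame\<close>

lemma evidenced_frame_core: "evidenced_frame preds S evid"
  unfolding evidenced_frame_def
proof (intro conjI)
  show "\<exists>eid\<in>S. \<forall>\<phi>\<in>preds. evid \<phi> eid \<phi>"
    using id_code_in evid_id by blast
  show "\<exists>comp. \<forall>e1\<in>S. \<forall>e2\<in>S. comp e1 e2 \<in> S \<and>
      (\<forall>\<phi>1\<in>preds. \<forall>\<phi>2\<in>preds. \<forall>\<phi>3\<in>preds.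
        evid \<phi>1 e1 \<phi>2 \<and> evid \<phi>2 e2 \<phi>3 \<longrightarrow> evid \<phi>1 (comp e1 e2) \<phi>3)"
    using comp_code_in evid_comp in_A by metis
qed (use ef_top_core ef_conj_core ef_univ_imp_core in blast)+

end

theorem theorem2:
  fixes Obj :: "'u set set"
    and M :: "'u set \<Rightarrow> 'u set"
    and eta :: "'u set \<Rightarrow> 'u \<Rightarrow> 'u"
    and bind :: "'u set \<Rightarrow> 'u set \<Rightarrow> 'u \<Rightarrow> ('u \<Rightarrow> 'u) \<Rightarrow> 'u"
    and A :: "'u set"
    and app :: "'u \<Rightarrow> 'u \<Rightarrow> 'u"
    and lam :: "nat \<Rightarrow> 'u expr \<Rightarrow> 'u"
    and Meet :: "'o::preorder set \<Rightarrow> 'o"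
    and one zero :: 'o
    and imp :: "'o \<Rightarrow> 'o \<Rightarrow> 'o"
    and D :: "'u set \<Rightarrow> 'u \<Rightarrow> ('u \<Rightarrow> 'o) \<Rightarrow> 'o"
    and S :: "'u set"
  assumes "monadic_core Obj M eta bind A app lam Meet one zero imp D S"
  shows "evidenced_frame (A \<rightarrow>\<^sub>E (UNIV :: 'o set)) S (core_evidence A app D)"
  using assms by (rule monadic_core.evidenced_frame_core)

end
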